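(* Let $(\psi,Y(0),Y(1))$ be a random vector with $\psi\in\mathbb{R}^d$, let $\sigma_d^2(\psi)=\mathrm{Var}(Y(d)\mid\psi)$ for $d=0,1$, let $p\in(0,1)$ be a constant, let $B>0$, and let $C:\mathbb{R}^d\to\mathbb{R}$ be a measurable cost function. Assume $E[Y(d)^2]<\infty$ for $d=0,1$, $\inf_\psi\sigma_d^2(\psi)\ge c>0$ for $d=0,1$, and $C(\psi)\in[C_l,C_u]\subset(0,\infty)$. Define $$\sigma_s^2(\psi)=\frac{\sigma_1^2(\psi)}{p}+\frac{\sigma_0^2(\psi)}{1-p},\qquad \sigma_s(\psi)=\sigma_s^2(\psi)^{1/2},\qquad q^*(\psi)=B\cdot\frac{\sigma_s(\psi)C(\psi)^{-1/2}}{E[\sigma_s(\psi)C(\psi)^{1/2}]}.$$ If $\sup_\psi q^*(\psi)\le1$, then $q^*$ is an optimal solution of $$\min_{0<q(\cdot)\le1}E\left[\frac{\sigma_s^2(\psi)}{q(\psi)}\right]\quad\text{subject to}\quad E[C(\psi)q(\psi)]=B,$$ where the minimum is over measurable functions $q:\mathbb{R}^d\to(0,1]$.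
   Context: All objects are introduced in the claim. Interpretation: $q(\psi)$ is the probability of sampling a unit with covariates $\psi$ into an experiment, $p$ the constant treatment probability, $C(\psi)$ the cost of including a unit of type $\psi$, and $B$ the budget. *)

theory Defs
  imports "HOL-Probability.Probability"
begin

text \<open>\<open>Var(Y | F) = E[(Y - E[Y | F])^2 | F]\<close>; as for the library's \<open>real_cond_exp\<close>, it is determined
  only up to null sets.\<close>
definition real_cond_var :: "'a measure \<Rightarrow> 'a measure \<Rightarrow> ('a \<Rightarrow> real) \<Rightarrow> 'a \<Rightarrow> real" where
  "real_cond_var M F Y = real_cond_exp M F (\<lambda>\<omega>. (Y \<omega> - real_cond_exp M F Y \<omega>)\<^sup>2)"

text \<open>\<open>v\<close> is a version of the function \<open>x \<mapsto> Var(Y | \<psi> = x)\<close>: a Borel function of the covariate value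
  such that \<open>v(\<psi>)\<close> is the conditional variance given the sigma-algebra generated by \<open>\<psi>\<close>.\<close>
definition cond_variance_fun ::
  "'a measure \<Rightarrow> ('a \<Rightarrow> real^'d) \<Rightarrow> ('a \<Rightarrow> real) \<Rightarrow> (real^'d \<Rightarrow> real) \<Rightarrow> bool" where
  "cond_variance_fun M \<psi> Y v \<longleftrightarrow>
     v \<in> borel_measurable borel \<and>
     (AE \<omega> in M. v (\<psi> \<omega>) = real_cond_var M (vimage_algebra (space M) \<psi> borel) Y \<omega>)"

definition sigma_s_sq :: "real \<Rightarrow> ('x \<Rightarrow> real) \<Rightarrow> ('x \<Rightarrow> real) \<Rightarrow> 'x \<Rightarrow> real" where
  "sigma_s_sq p v0 v1 x = v1 x / p + v0 x / (1 - p)"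

definition sigma_s :: "real \<Rightarrow> ('x \<Rightarrow> real) \<Rightarrow> ('x \<Rightarrow> real) \<Rightarrow> 'x \<Rightarrow> real" where
  "sigma_s p v0 v1 x = sqrt (sigma_s_sq p v0 v1 x)"

definition q_star ::
  "'a measure \<Rightarrow> ('a \<Rightarrow> real^'d) \<Rightarrow> real \<Rightarrow> real \<Rightarrow> (real^'d \<Rightarrow> real) \<Rightarrow> (real^'d \<Rightarrow> real) \<Rightarrow>
   (real^'d \<Rightarrow> real) \<Rightarrow> real^'d \<Rightarrow> real" where
  "q_star M \<psi> p B C v0 v1 x =
     B * (sigma_s p v0 v1 x * C x powr (- 1/2) /
          (\<integral>\<omega>. sigma_s p v0 v1 (\<psi> \<omega>) * C (\<psi> \<omega>) powr (1/2) \<partial>M))"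

definition feasible ::
  "'a measure \<Rightarrow> ('a \<Rightarrow> real^'d) \<Rightarrow> real \<Rightarrow> (real^'d \<Rightarrow> real) \<Rightarrow> (real^'d \<Rightarrow> real) \<Rightarrow> bool" where
  "feasible M \<psi> B C q \<longleftrightarrow>
     q \<in> borel_measurable borel \<and> (\<forall>x. 0 < q x \<and> q x \<le> 1) \<and>
     (\<integral>\<omega>. C (\<psi> \<omega>) * q (\<psi> \<omega>) \<partial>M) = B"

text \<open>The expectation is \<open>[0, \<infinity>]\<close>-valued: \<open>q\<close> need not be bounded away from 0, so a feasible \<open>q\<close> may
  have infinite objective, whereas the Bochner integral would then be 0 by convention.\<close>
definition objective ::
  "'a measure \<Rightarrow> ('a \<Rightarrow> real^'d) \<Rightarrow> real \<Rightarrow> (real^'d \<Rightarrow> real) \<Rightarrow> (real^'d \<Rightarrow> real) \<Rightarrow>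
   (real^'d \<Rightarrow> real) \<Rightarrow> ennreal" where
  "objective M \<psi> p v0 v1 q = (\<integral>\<^sup>+\<omega>. ennreal (sigma_s_sq p v0 v1 (\<psi> \<omega>) / q (\<psi> \<omega>)) \<partial>M)"

end

theory Submission
  imports Defs
begin

text \<open>With \<open>D = E[\<sigma>\<^sub>s C\<^sup>1\<^sup>/\<^sup>2]\<close>, the pointwise inequality
  \<open>\<sigma>\<^sub>s\<^sup>2 / q + (D/B)\<^sup>2 C q \<ge> 2 (D/B) \<sigma>\<^sub>s C\<^sup>1\<^sup>/\<^sup>2\<close> integrates to \<open>E[\<sigma>\<^sub>s\<^sup>2 / q] \<ge> D\<^sup>2 / B\<close> for every
  feasible \<open>q\<close>, and \<open>q\<^sup>*\<close> attains this bound. The moment assumption on \<open>Y(d)\<close> makes \<open>D\<close> finite.\<close>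

lemma subalgebra_vimage_algebra:
  assumes "f \<in> measurable M N"
  shows "subalgebra M (vimage_algebra (space M) f N)"
  using assms by (auto simp: subalgebra_def sets_vimage_algebra2 measurable_space
      intro: measurable_sets)

text \<open>Conditional Jensen for the square makes \<open>E[Y | F]\<close> square-integrable along
  with \<open>Y\<close>. Hence the squared residual is integrable, and conditioning preserves
  integrability.\<close>

lemma (in finite_measure_subalgebra) integrable_real_cond_var:
  assumes [measurable]: "Y \<in> borel_measurable M"
    and Y2: "integrable M (\<lambda>x. (Y x)\<^sup>2)"
  shows "integrable M (real_cond_var M F Y)"
proof -
  let ?m = "real_cond_exp M F Y"
  have Y: "integrable M Y"
    using Y2 by (rule square_integrable_imp_integrable[rotated]) simp
  have [measurable]: "?m \<in> borel_measurable M"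
    by (rule borel_measurable_cond_exp2)
  have m2: "integrable M (\<lambda>x. (?m x)\<^sup>2)"
    by (rule integrable_convex_cond_exp[where I = UNIV and X = Y])
      (use Y Y2 in \<open>auto simp: convex_power2\<close>)
  have "integrable M (\<lambda>x. (Y x - ?m x)\<^sup>2)"
  proof (rule Bochner_Integration.integrable_bound)
    show "integrable M (\<lambda>x. 2 * (Y x)\<^sup>2 + 2 * (?m x)\<^sup>2)"
      using Y2 m2 by simp
    \<comment> \<open>The right side minus the left side is \<open>(a + b)^2\<close>.\<close>
    have "(a - b)\<^sup>2 \<le> 2 * a\<^sup>2 + 2 * b\<^sup>2" for a b :: real
      using zero_le_power2[of "a + b"] by (simp add: power2_eq_square algebra_simps)
    then show "AE x in M. norm ((Y x - ?m x)\<^sup>2) \<le> norm (2 * (Y x)\<^sup>2 + 2 * (?m x)\<^sup>2)"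
      by simp
  qed measurable
  then show ?thesis
    unfolding real_cond_var_def by (rule real_cond_exp_int)
qed

text \<open>Turns the second-moment assumption into integrability of the variance function along
  \<open>\<psi>\<close>: the two versions agree almost everywhere, and \<open>v\<close> being Borel
  supplies the measurability that the transfer needs.\<close>

lemma (in prob_space) integrable_cond_variance_fun:
  assumes [measurable]: "\<psi> \<in> borel_measurable M" "Y \<in> borel_measurable M"
    and Y2: "integrable M (\<lambda>\<omega>. (Y \<omega>)\<^sup>2)"
    and v: "cond_variance_fun M \<psi> Y v"
  shows "integrable M (\<lambda>\<omega>. v (\<psi> \<omega>))"
proof -
  let ?F = "vimage_algebra (space M) \<psi> borel"
  interpret finite_measure_subalgebra M ?F
    by unfold_locales (simp add: subalgebra_vimage_algebra)
  have "integrable M (real_cond_var M ?F Y)"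
    using Y2 by (intro integrable_real_cond_var) simp_all
  moreover have [measurable]: "v \<in> borel_measurable borel"
    and "AE \<omega> in M. v (\<psi> \<omega>) = real_cond_var M ?F Y \<omega>"
    using v by (auto simp: cond_variance_fun_def)
  ultimately show ?thesis
    by (subst integrable_cong_AE[where g = "real_cond_var M ?F Y"]) auto
qed

text \<open>This is Cauchy-Schwarz for \<open>sqrt (s / q)\<close> and \<open>sqrt (k * q)\<close>,
  whose product is free of \<open>q\<close>. It is applied with \<open>s\<close> the variance term
  and \<open>k\<close> the cost.\<close>

lemma nn_integral_divide_ge_square_integral_sqrt:
  fixes s k q :: "'a \<Rightarrow> real"
  assumes [measurable]: "s \<in> borel_measurable M" "q \<in> borel_measurable M"
    and int_sqrt: "integrable M (\<lambda>x. sqrt (s x * k x))"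
    and int_kq: "integrable M (\<lambda>x. k x * q x)"
    and nonneg: "\<And>x. 0 \<le> s x" "\<And>x. 0 \<le> k x"
    and q_pos: "\<And>x. 0 < q x"
    and B: "(\<integral>x. k x * q x \<partial>M) = B" "0 < B"
  shows "ennreal ((\<integral>x. sqrt (s x * k x) \<partial>M)\<^sup>2 / B) \<le> (\<integral>\<^sup>+x. ennreal (s x / q x) \<partial>M)"
\<comment> \<open>An infinite right side needs no argument; a finite one makes \<open>s / q\<close>
  integrable, so that real-valued integrals can be compared.\<close>
proof (cases "(\<integral>\<^sup>+x. ennreal (s x / q x) \<partial>M) < \<infinity>")
  case True
  define D where "D = (\<integral>x. sqrt (s x * k x) \<partial>M)"
  have sq_nonneg: "0 \<le> s x / q x" for x
    using nonneg(1)[of x] q_pos[of x] by simp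
  have int_sq: "integrable M (\<lambda>x. s x / q x)"
    using True sq_nonneg by (intro integrableI_nonneg) auto
  \<comment> \<open>Any factor \<open>t\<close> in place of \<open>D / B\<close> gives a valid
    bound, with integral \<open>2 * t * D - t^2 * B\<close>; \<open>t = D / B\<close> maximizes
    it.\<close>
  have pointwise: "2 * (D / B) * sqrt (s x * k x) - (D / B)\<^sup>2 * (k x * q x) \<le> s x / q x" for x
  proof -
    have "0 \<le> (sqrt (s x / q x) - D / B * sqrt (k x * q x))\<^sup>2"
      by simp
    also have "\<dots> = s x / q x - 2 * (D / B) * (sqrt (s x / q x) * sqrt (k x * q x))
        + (D / B)\<^sup>2 * (k x * q x)"
      using nonneg(1,2)[of x] q_pos[of x]
      by (simp add: power2_diff power_mult_distrib power_divide)
    also have "sqrt (s x / q x) * sqrt (k x * q x) = sqrt (s x * k x)"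
      using q_pos[of x] by (simp flip: real_sqrt_mult)
    finally show ?thesis
      by simp
  qed
  have "D\<^sup>2 / B = 2 * (D / B) * D - (D / B)\<^sup>2 * B"
    using B(2) by (simp add: field_simps power2_eq_square)
  also have "\<dots> = (\<integral>x. 2 * (D / B) * sqrt (s x * k x) - (D / B)\<^sup>2 * (k x * q x) \<partial>M)"
    using int_sqrt int_kq B(1) by (simp add: D_def)
  also have "\<dots> \<le> (\<integral>x. s x / q x \<partial>M)"
    using int_sqrt int_kq int_sq pointwise by (intro integral_mono) auto
  finally show ?thesis
    unfolding D_def using int_sq sq_nonneg by (simp add: nn_integral_eq_integral ennreal_leI)
next
  case False
  then show ?thesis
    by (metis infinity_ennreal_def top.not_eq_extremum top_greatest)
qed

theorem theorem5p1:
  fixes M :: "'a measure"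
    and \<psi> :: "'a \<Rightarrow> real ^ 'd"
    and Y0 Y1 :: "'a \<Rightarrow> real"
    and v0 v1 C :: "real ^ 'd \<Rightarrow> real"
    and p B c C\<^sub>l C\<^sub>u :: real
  assumes "prob_space M"
    and "\<psi> \<in> borel_measurable M"
    and "Y0 \<in> borel_measurable M" and "Y1 \<in> borel_measurable M"
    and "cond_variance_fun M \<psi> Y0 v0" and "cond_variance_fun M \<psi> Y1 v1"
    and "0 < p" and "p < 1"
    and "0 < B"
    and "C \<in> borel_measurable borel"
    and "integrable M (\<lambda>\<omega>. (Y0 \<omega>)\<^sup>2)" and "integrable M (\<lambda>\<omega>. (Y1 \<omega>)\<^sup>2)"
    and "0 < c" and "\<forall>x. c \<le> v0 x" and "\<forall>x. c \<le> v1 x"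
    and "0 < C\<^sub>l" and "\<forall>x. C x \<in> {C\<^sub>l..C\<^sub>u}"
    and "\<forall>x. q_star M \<psi> p B C v0 v1 x \<le> 1"
  shows "is_arg_min (objective M \<psi> p v0 v1) (feasible M \<psi> B C) (q_star M \<psi> p B C v0 v1)"
proof -
  interpret prob_space M by fact
  note [measurable] = \<open>\<psi> \<in> borel_measurable M\<close> \<open>Y0 \<in> borel_measurable M\<close>
    \<open>Y1 \<in> borel_measurable M\<close> \<open>C \<in> borel_measurable borel\<close>
  have [measurable]: "v0 \<in> borel_measurable borel" "v1 \<in> borel_measurable borel"
    using assms(5,6) by (auto simp: cond_variance_fun_def)
  define S where "S = sigma_s_sq p v0 v1"
  have [measurable]: "S \<in> borel_measurable borel"
    unfolding S_def sigma_s_sq_def by measurable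
  have v_pos: "0 < v0 x" "0 < v1 x" for x
    using assms(13-15) by (auto intro: less_le_trans)
  have S_pos: "0 < S x" for x
    using v_pos[of x] assms(7,8) by (simp add: S_def sigma_s_sq_def add_pos_pos)
  have C_pos: "0 < C x" and C_le: "C x \<le> C\<^sub>u" for x
    using assms(16,17) by (auto intro: less_le_trans)

  have int_S: "integrable M (\<lambda>\<omega>. S (\<psi> \<omega>))"
    unfolding S_def sigma_s_sq_def
    using integrable_cond_variance_fun[OF assms(2,3,11,5)]
      integrable_cond_variance_fun[OF assms(2,4,12,6)] by simp
  have int_SC: "integrable M (\<lambda>\<omega>. sqrt (S (\<psi> \<omega>) * C (\<psi> \<omega>)))"
  proof (rule Bochner_Integration.integrable_bound)
    show "integrable M (\<lambda>\<omega>. S (\<psi> \<omega>) + C\<^sub>u)"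
      using int_S by simp
    \<comment> \<open>By AM-GM the root is at most \<open>(S x + C x) / 2\<close>, and the cost is
      bounded.\<close>
    have "norm (sqrt (S x * C x)) \<le> norm (S x + C\<^sub>u)" for x
      using arith_geo_mean_sqrt[of "S x" "C x"] S_pos[of x] C_pos[of x] C_le[of x]
      by (simp add: abs_mult)
    then show "AE \<omega> in M. norm (sqrt (S (\<psi> \<omega>) * C (\<psi> \<omega>))) \<le> norm (S (\<psi> \<omega>) + C\<^sub>u)"
      by simp
  qed measurable

  define D where "D = (\<integral>\<omega>. sqrt (S (\<psi> \<omega>) * C (\<psi> \<omega>)) \<partial>M)"
  \<comment> \<open>The integrand is positive everywhere and the total mass is 1. Were
    \<open>D\<close> zero, division by zero would make \<open>?q\<close> vanish and so be
    infeasible.\<close>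
  have D_pos: "0 < D"
    using integral_less_AE_space[of "\<lambda>_. 0" "\<lambda>\<omega>. sqrt (S (\<psi> \<omega>) * C (\<psi> \<omega>))"] int_SC S_pos C_pos
    by (simp add: D_def emeasure_space_1)
  let ?q = "q_star M \<psi> p B C v0 v1"
  have q_star_eq: "?q x = B / D * (sqrt (S x) / sqrt (C x))" for x
    using C_pos less_imp_le[OF C_pos]
    by (simp add: q_star_def sigma_s_def S_def D_def powr_half_sqrt powr_minus_divide real_sqrt_mult)
  have q_star_pos: "0 < ?q x" for x
    unfolding q_star_eq using S_pos C_pos D_pos \<open>0 < B\<close> by simp
  have [measurable]: "?q \<in> borel_measurable borel"
    unfolding q_star_eq[abs_def] by measurable

  \<comment> \<open>The cost density of \<open>?q\<close> is a multiple of the integrand of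
    \<open>D\<close>, and the factor \<open>B / D\<close> makes it spend exactly
    \<open>B\<close>.\<close>
  have "C x * ?q x = B / D * sqrt (S x * C x)" for x
  proof -
    have "C x * ?q x = B / D * (sqrt (S x) * (C x / sqrt (C x)))"
      by (simp add: q_star_eq)
    then show ?thesis
      using C_pos[of x] by (simp only: real_div_sqrt less_imp_le real_sqrt_mult)
  qed
  then have "(\<integral>\<omega>. C (\<psi> \<omega>) * ?q (\<psi> \<omega>) \<partial>M) = B"
    using D_pos by (simp flip: D_def)
  then have feas: "feasible M \<psi> B C ?q"
    using q_star_pos assms(18) by (auto simp: feasible_def)

  \<comment> \<open>Equality case of Cauchy-Schwarz: \<open>S / ?q\<close> and \<open>C * ?q\<close>
    are both proportional to \<open>sqrt (S * C)\<close>.\<close>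
  have "S x / ?q x = D / B * sqrt (S x * C x)" for x
    unfolding q_star_eq using real_sqrt_mult_self[of "S x"] S_pos[of x] C_pos[of x] D_pos \<open>0 < B\<close>
    by (simp add: real_sqrt_mult field_simps)
  then have "objective M \<psi> p v0 v1 ?q = (\<integral>\<^sup>+\<omega>. ennreal (D / B * sqrt (S (\<psi> \<omega>) * C (\<psi> \<omega>))) \<partial>M)"
    by (simp add: objective_def flip: S_def)
  also have "\<dots> = ennreal (D\<^sup>2 / B)"
    using int_SC S_pos C_pos D_pos \<open>0 < B\<close>
    by (subst nn_integral_eq_integral) (auto simp: power2_eq_square less_imp_le simp flip: D_def)
  finally have obj: "objective M \<psi> p v0 v1 ?q = ennreal (D\<^sup>2 / B)" .

  have "ennreal (D\<^sup>2 / B) \<le> objective M \<psi> p v0 v1 q" if q: "feasible M \<psi> B C q" for q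
  proof -
    have [measurable]: "q \<in> borel_measurable borel"
      and q01: "0 < q x" "q x \<le> 1" and qB: "(\<integral>\<omega>. C (\<psi> \<omega>) * q (\<psi> \<omega>) \<partial>M) = B" for x
      using q by (auto simp: feasible_def)
    \<comment> \<open>The constraint \<open>q \<le> 1\<close> bounds the cost density, which is
      therefore integrable on a probability space.\<close>
    have "C x * q x \<le> C\<^sub>u" for x
      using mult_left_le[of "q x" "C x"] q01[of x] C_pos[of x] C_le[of x] by linarith
    then have "integrable M (\<lambda>\<omega>. C (\<psi> \<omega>) * q (\<psi> \<omega>))"
      using q01(1) C_pos
      by (intro integrable_const_bound[where B = "C\<^sub>u"]) (auto simp: abs_mult less_imp_le)
    then show ?thesis
      unfolding objective_def D_def S_def[symmetric]
      using int_SC S_pos C_pos q01(1) qB \<open>0 < B\<close>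
      by (intro nn_integral_divide_ge_square_integral_sqrt) (auto simp: less_imp_le)
  qed
  then show ?thesis
    using feas obj by (auto simp: is_arg_min_linorder)
qed

end
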